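(* For every finite family $(\alpha_i)_{i\in I}$ of ordinals, the complex algebras of the direct products $\prod_{i\in I}(\alpha_i,\leq)$ and $\prod_{i\in I}(\alpha_i,<)$ are both locally finite.
   Context: The direct product of Kripke frames $(X_i,R_i)_{i\in I}$ is the frame $(\prod_{i\in I}X_i,R)$ with $xRy$ iff $x_iR_iy_i$ for all $i\in I$. Here $\leq$ and $<$ are the usual non-strict and strict orders on ordinals. The complex algebra of a Kripke frame $(X,R)$ is the modal algebra $(\mathcal{P}(X),\Diamond_R)$, where $\Diamond_R U=R^{-1}[U]=\{x\in X\mid\exists u\in U\ (xRu)\}$. An algebra is locally finite if each of its finitely generated subalgebras is finite (subalgebras here are closed under the Boolean operations and $\Diamond_R$). *)

theory Defs
  imports Main "HOL-Library.FuncSet"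
begin

record 'a kripke_frame =
  worlds :: "'a set"
  acc :: "('a \<times> 'a) set"

text \<open>
  Points of a product are extensional functions, so that each family of points is represented by
  exactly one function; the empty product has a single point, which is reflexive.
\<close>

definition direct_product ::
  "'i set \<Rightarrow> ('i \<Rightarrow> 'a kripke_frame) \<Rightarrow> ('i \<Rightarrow> 'a) kripke_frame" where
  "direct_product I F =
    (let X = (\<Pi>\<^sub>E i\<in>I. worlds (F i))
     in \<lparr>worlds = X, acc = {(x, y) \<in> X \<times> X. \<forall>i\<in>I. (x i, y i) \<in> acc (F i)}\<rparr>)"

text \<open>
  An ordinal is given by a well-order relation (\<^const>\<open>Well_order\<close>), which is reflexive on its
  field; the elements of the ordinal are the elements of the field. The empty relation is the
  ordinal zero.
\<close>

definition ord_le_frame :: "'a rel \<Rightarrow> 'a kripke_frame" where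
  "ord_le_frame \<alpha> = \<lparr>worlds = Field \<alpha>, acc = \<alpha>\<rparr>"

definition ord_less_frame :: "'a rel \<Rightarrow> 'a kripke_frame" where
  "ord_less_frame \<alpha> = \<lparr>worlds = Field \<alpha>, acc = \<alpha> - Id\<rparr>"

record 'b modal_algebra =
  carrier :: "'b set"
  bot_op :: 'b
  top_op :: 'b
  meet_op :: "'b \<Rightarrow> 'b \<Rightarrow> 'b"
  join_op :: "'b \<Rightarrow> 'b \<Rightarrow> 'b"
  compl_op :: "'b \<Rightarrow> 'b"
  dia_op :: "'b \<Rightarrow> 'b"

definition complex_algebra :: "'a kripke_frame \<Rightarrow> 'a set modal_algebra" where
  "complex_algebra F =
    \<lparr>carrier = Pow (worlds F),
     bot_op = {},
     top_op = worlds F,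
     meet_op = (\<inter>),
     join_op = (\<union>),
     compl_op = (\<lambda>U. worlds F - U),
     dia_op = (\<lambda>U. {x \<in> worlds F. \<exists>u\<in>U. (x, u) \<in> acc F})\<rparr>"

definition subalgebra :: "'b set \<Rightarrow> 'b modal_algebra \<Rightarrow> bool" where
  "subalgebra B A \<longleftrightarrow>
    B \<subseteq> carrier A \<and> bot_op A \<in> B \<and> top_op A \<in> B \<and>
    (\<forall>a\<in>B. \<forall>b\<in>B. meet_op A a b \<in> B) \<and>
    (\<forall>a\<in>B. \<forall>b\<in>B. join_op A a b \<in> B) \<and>
    (\<forall>a\<in>B. compl_op A a \<in> B) \<and>
    (\<forall>a\<in>B. dia_op A a \<in> B)"

definition generated_subalgebra :: "'b modal_algebra \<Rightarrow> 'b set \<Rightarrow> 'b set" where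
  "generated_subalgebra A G = \<Inter>{B. subalgebra B A \<and> G \<subseteq> B}"

definition locally_finite :: "'b modal_algebra \<Rightarrow> bool" where
  "locally_finite A \<longleftrightarrow>
    (\<forall>G. G \<subseteq> carrier A \<and> finite G \<longrightarrow> finite (generated_subalgebra A G))"

lemma subalgebra_carrier_complex_algebra:
  "subalgebra (carrier (complex_algebra F)) (complex_algebra F)"
  by (auto simp: subalgebra_def complex_algebra_def)

lemma subalgebra_generated_subalgebra:
  assumes "G \<subseteq> carrier (complex_algebra F)"
  shows "subalgebra (generated_subalgebra (complex_algebra F) G) (complex_algebra F)"
proof -
  have "generated_subalgebra (complex_algebra F) G \<subseteq> carrier (complex_algebra F)"
    using assms subalgebra_carrier_complex_algebra
    unfolding generated_subalgebra_def by blast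
  then show ?thesis
    unfolding generated_subalgebra_def subalgebra_def by blast
qed

end

theory Submission imports Defs Complex_Main begin

text \<open>
  It suffices to refine every finite colouring of the product to a finite partition that is tuned:
  if one point of a block sees a given block, then all of its points do.

  Call a product of initial segments a box. Boxes are directed, closed under intersection, and
  well-founded under strict inclusion. If a colour is not cofinal in a box \<open>E\<close>, then no point of this
  colour in \<open>E\<close> lies above some \<open>a \<in> E\<close>, so these points are covered by the finitely many proper
  subboxes \<open>{y \<in> E. y i < a i}\<close>. Well-foundedness yields a finite intersection-closed family of boxes
  containing these covers for each of its members. Sort points by colour and by the least member of
  the family containing them. A colour that occurs among the points with least box \<open>E\<close> is cofinal
  in \<open>E\<close>, even inside this set of points, because by directedness finitely many proper subboxes do
  not exhaust \<open>E\<close> above any of its points. Hence a point sees the block of \<open>E\<close> and of an occurring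
  colour as soon as it lies in \<open>E\<close>. For the strict order one also cuts off the maximum of each
  coordinate that has one.
\<close>

section \<open>From tuned partitions to local finiteness\<close>

text \<open>The unions of blocks of \<open>k\<close> form a finite subalgebra containing
  \<open>G\<close>, so the generated subalgebra lies inside it. Closure under the diamond is what
  the last condition gives: if one point of a block sees a union of blocks, then so does every point
  of the block.\<close>

lemma locally_finite_complex_algebraI:
  fixes F :: "'a kripke_frame"
  assumes tuned: "\<And>G. \<lbrakk>finite G; G \<subseteq> Pow (worlds F)\<rbrakk> \<Longrightarrow>
    \<exists>k :: 'a \<Rightarrow> 'b. finite (k ` worlds F) \<and>
      (\<forall>U\<in>G. \<forall>x\<in>worlds F. \<forall>y\<in>worlds F. k x = k y \<longrightarrow> x \<in> U \<longrightarrow> y \<in> U) \<and>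
      (\<forall>x\<in>worlds F. \<forall>x'\<in>worlds F. \<forall>y\<in>worlds F. k x = k x' \<longrightarrow> (x, y) \<in> acc F \<longrightarrow>
        (\<exists>y'\<in>worlds F. k y' = k y \<and> (x', y') \<in> acc F))"
  shows "locally_finite (complex_algebra F)"
  unfolding locally_finite_def
proof (intro allI impI)
  fix G assume G: "G \<subseteq> carrier (complex_algebra F) \<and> finite G"
  let ?X = "worlds F"
  have "finite G" "G \<subseteq> Pow ?X" using G by (simp_all add: complex_algebra_def)
  from tuned[OF this] obtain k :: "'a \<Rightarrow> 'b" where fin: "finite (k ` ?X)"
    and sat: "\<forall>U\<in>G. \<forall>x\<in>?X. \<forall>y\<in>?X. k x = k y \<longrightarrow> x \<in> U \<longrightarrow> y \<in> U"
    and tun: "\<forall>x\<in>?X. \<forall>x'\<in>?X. \<forall>y\<in>?X. k x = k x' \<longrightarrow> (x, y) \<in> acc F \<longrightarrow>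
      (\<exists>y'\<in>?X. k y' = k y \<and> (x', y') \<in> acc F)"
    by (elim exE conjE) (rule that)
  define B where "B = {U. U \<subseteq> ?X \<and> (\<forall>x\<in>?X. \<forall>y\<in>?X. k x = k y \<longrightarrow> x \<in> U \<longrightarrow> y \<in> U)}"
  have B_sat: "y \<in> U" if "U \<in> B" "x \<in> ?X" "y \<in> ?X" "k x = k y" "x \<in> U" for U x y
    using that unfolding B_def by blast
  \<comment> \<open>A union of blocks is determined by the set of labels that \<open>k\<close> takes
    on it.\<close>
  have "B \<subseteq> (\<lambda>S. {x\<in>?X. k x \<in> S}) ` Pow (k ` ?X)"
  proof
    fix U assume "U \<in> B"
    then have "U \<subseteq> ?X" unfolding B_def by blast
    have "{x\<in>?X. k x \<in> k ` U} \<subseteq> U"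
    proof
      fix x assume "x \<in> {x\<in>?X. k x \<in> k ` U}"
      then obtain u where "x \<in> ?X" "u \<in> U" "k u = k x" by force
      then show "x \<in> U" using B_sat[OF \<open>U \<in> B\<close>] \<open>U \<subseteq> ?X\<close> by blast
    qed
    then have "U = {x\<in>?X. k x \<in> k ` U}" using \<open>U \<subseteq> ?X\<close> by blast
    moreover have "k ` U \<in> Pow (k ` ?X)" using \<open>U \<subseteq> ?X\<close> by (simp add: image_mono)
    ultimately show "U \<in> (\<lambda>S. {x\<in>?X. k x \<in> S}) ` Pow (k ` ?X)"
      by blast
  qed
  then have "finite B"
    using fin by (meson finite_Pow_iff finite_imageI finite_subset)
  moreover have "subalgebra B (complex_algebra F)"
  proof -
    have "{x \<in> ?X. \<exists>u\<in>U. (x, u) \<in> acc F} \<in> B" if "U \<in> B" for U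
      unfolding B_def
    proof (rule CollectI, intro conjI ballI impI)
      fix x x' assume x: "x \<in> ?X" "x' \<in> ?X" "k x = k x'" "x \<in> {x \<in> ?X. \<exists>u\<in>U. (x, u) \<in> acc F}"
      then obtain u where u: "u \<in> U" "(x, u) \<in> acc F" by blast
      with \<open>U \<in> B\<close> have "u \<in> ?X" unfolding B_def by blast
      then obtain y' where "y' \<in> ?X" "k y' = k u" "(x', y') \<in> acc F"
        using tun x u by blast
      moreover from this have "y' \<in> U"
        using B_sat[OF \<open>U \<in> B\<close> \<open>u \<in> ?X\<close>] u by simp
      ultimately show "x' \<in> {x \<in> ?X. \<exists>u\<in>U. (x, u) \<in> acc F}"
        using x by blast
    qed blast
    moreover have "?X - U \<in> B" if "U \<in> B" for U
      using B_sat[OF that] unfolding B_def by (intro CollectI conjI ballI impI DiffI) (blast, blast, metis DiffD2)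
    moreover have "B \<subseteq> Pow ?X" "{} \<in> B" "?X \<in> B" unfolding B_def by blast+
    moreover have "U \<inter> V \<in> B" "U \<union> V \<in> B" if "U \<in> B" "V \<in> B" for U V
      using that unfolding B_def by blast+
    ultimately show ?thesis
      unfolding subalgebra_def by (simp add: complex_algebra_def)
  qed
  moreover have "G \<subseteq> B"
    using G sat unfolding B_def complex_algebra_def by fastforce
  ultimately show "finite (generated_subalgebra (complex_algebra F) G)"
    unfolding generated_subalgebra_def
    by (metis (mono_tags, lifting) Inter_lower finite_subset mem_Collect_eq)
qed

section \<open>Finite intersection-closed families\<close>

definition Int_closed :: "'a set set \<Rightarrow> bool" where
  "Int_closed \<F> \<longleftrightarrow> (\<forall>A\<in>\<F>. \<forall>B\<in>\<F>. A \<inter> B \<in> \<F>)"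

lemma Int_closed_Inter:
  assumes "Int_closed \<F>" "finite \<G>" "\<G> \<noteq> {}" "\<G> \<subseteq> \<F>"
  shows "\<Inter>\<G> \<in> \<F>"
  using assms(2-4)
proof (induction \<G> rule: finite_ne_induct)
  case (insert A \<G>)
  then show ?case using assms(1) by (auto simp: Int_closed_def)
qed simp

text \<open>Finitely many sets have only finitely many intersections. The last clause serves to
  trace a member back to the sets of \<G> that cut it out.\<close>

lemma Int_closure_exists:
  assumes "finite \<G>"
  obtains \<F> where "finite \<F>" "Int_closed \<F>" "\<G> \<subseteq> \<F>"
    "\<And>A. A \<in> \<F> \<Longrightarrow> \<exists>\<H>\<subseteq>\<G>. \<H> \<noteq> {} \<and> A = \<Inter>\<H>"
proof
  let ?F = "Inter ` (Pow \<G> - {{}})"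
  show "finite ?F" using assms by simp
  show "Int_closed ?F"
    unfolding Int_closed_def
  proof (intro ballI)
    fix A B assume "A \<in> ?F" "B \<in> ?F"
    then obtain \<H> \<K> where "A = \<Inter>\<H>" "B = \<Inter>\<K>" "\<H> \<in> Pow \<G> - {{}}" "\<K> \<in> Pow \<G> - {{}}"
      by blast
    then have "A \<inter> B = \<Inter>(\<H> \<union> \<K>)" "\<H> \<union> \<K> \<in> Pow \<G> - {{}}" by auto
    then show "A \<inter> B \<in> ?F" by blast
  qed
  show "\<G> \<subseteq> ?F"
  proof
    fix A assume "A \<in> \<G>"
    then have "A = \<Inter>{A}" "{A} \<in> Pow \<G> - {{}}" by auto
    then show "A \<in> ?F" by blast
  qed
  show "\<And>A. A \<in> ?F \<Longrightarrow> \<exists>\<H>\<subseteq>\<G>. \<H> \<noteq> {} \<and> A = \<Inter>\<H>" by blast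
qed

text \<open>
  New members are required to lie below \<open>E\<close> so that closing off the members below \<open>E\<close> one after
  another does not create unfinished members elsewhere.
\<close>
lemma finite_Int_closed_cover_closed_below:
  assumes wf: "wf {(A, B). A \<in> \<B> \<and> B \<in> \<B> \<and> A \<subset> B}"
    and Int: "Int_closed \<B>"
    and C: "\<And>A. A \<in> \<B> \<Longrightarrow> finite (C A)" "\<And>A D. \<lbrakk>A \<in> \<B>; D \<in> C A\<rbrakk> \<Longrightarrow> D \<in> \<B> \<and> D \<subset> A"
    and "E \<in> \<F>" "finite \<F>" "\<F> \<subseteq> \<B>" "Int_closed \<F>"
  shows "\<exists>\<F>'. finite \<F>' \<and> \<F>' \<subseteq> \<B> \<and> Int_closed \<F>' \<and> \<F> \<subseteq> \<F>' \<and> (\<forall>A\<in>\<F>' - \<F>. A \<subseteq> E) \<and>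
    (\<forall>A\<in>\<F>'. A \<subseteq> E \<longrightarrow> C A \<subseteq> \<F>')"
  using assms(5-8)
proof (induction E arbitrary: \<F> rule: wf_induct_rule[OF wf])
  case (1 E)
  have EB: "E \<in> \<B>" using "1.prems"(1,3) by blast
  have CE: "finite (C E)" "C E \<subseteq> \<B>" "\<forall>D\<in>C E. D \<subset> E" using C EB by blast+
  obtain \<F>1 where F1: "finite \<F>1" "Int_closed \<F>1" "\<F> \<union> C E \<subseteq> \<F>1"
    and F1': "\<And>A. A \<in> \<F>1 \<Longrightarrow> \<exists>\<H>\<subseteq>\<F> \<union> C E. \<H> \<noteq> {} \<and> A = \<Inter>\<H>"
    using Int_closure_exists[of "\<F> \<union> C E"] \<open>finite \<F>\<close> CE by (metis finite_UnI)
  have F1B: "\<F>1 \<subseteq> \<B>"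
  proof
    fix A assume "A \<in> \<F>1"
    then obtain \<H> where "\<H> \<subseteq> \<F> \<union> C E" "\<H> \<noteq> {}" "A = \<Inter>\<H>" using F1' by blast
    moreover from this have "finite \<H>" "\<H> \<subseteq> \<B>"
      using \<open>finite \<F>\<close> CE \<open>\<F> \<subseteq> \<B>\<close> by (auto intro: finite_subset)
    ultimately show "A \<in> \<B>" using Int_closed_Inter[OF Int] by blast
  qed
  have F1E: "A \<subset> E" if A: "A \<in> \<F>1 - \<F>" for A
  proof -
    obtain \<H> where H: "\<H> \<subseteq> \<F> \<union> C E" "\<H> \<noteq> {}" "A = \<Inter>\<H>" using F1' A by blast
    \<comment> \<open>Intersections of old members are old, so a new one involves a set of
      \<open>C E\<close> and lies strictly below \<open>E\<close>.\<close>
    have "\<not> \<H> \<subseteq> \<F>"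
    proof
      assume "\<H> \<subseteq> \<F>"
      then have "A \<in> \<F>"
        using H Int_closed_Inter[OF \<open>Int_closed \<F>\<close>] \<open>finite \<F>\<close> finite_subset by blast
      then show False using A by blast
    qed
    then show ?thesis using H CE by blast
  qed
  \<comment> \<open>The members of \<open>\<F>1\<close> strictly below \<open>E\<close> are treated
    one at a time by the outer induction hypothesis. \<S> collects those already treated; members
    outside \<open>\<F>1\<close> are complete at every stage.\<close>
  have "\<exists>\<F>'. finite \<F>' \<and> \<F>' \<subseteq> \<B> \<and> Int_closed \<F>' \<and> \<F>1 \<subseteq> \<F>' \<and> (\<forall>A\<in>\<F>' - \<F>1. A \<subset> E) \<and>
      (\<forall>A\<in>\<F>'. A \<in> \<S> \<or> A \<notin> \<F>1 \<longrightarrow> C A \<subseteq> \<F>')"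
    if "finite \<S>" "\<S> \<subseteq> {A\<in>\<F>1. A \<subset> E}" for \<S>
    using that
  proof (induction \<S> rule: finite_induct)
    case empty
    then show ?case using F1 F1B by blast
  next
    case (insert S \<S>)
    then obtain \<F>2 where F2: "finite \<F>2" "\<F>2 \<subseteq> \<B>" "Int_closed \<F>2" "\<F>1 \<subseteq> \<F>2"
      "\<forall>A\<in>\<F>2 - \<F>1. A \<subset> E" "\<forall>A\<in>\<F>2. A \<in> \<S> \<or> A \<notin> \<F>1 \<longrightarrow> C A \<subseteq> \<F>2" by auto
    have S: "S \<in> \<F>2" "(S, E) \<in> {(A, B). A \<in> \<B> \<and> B \<in> \<B> \<and> A \<subset> B}" "S \<subset> E"
      using insert F2 EB by auto
    obtain \<F>3 where F3: "finite \<F>3" "\<F>3 \<subseteq> \<B>" "Int_closed \<F>3" "\<F>2 \<subseteq> \<F>3"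
      "\<forall>A\<in>\<F>3 - \<F>2. A \<subseteq> S" "\<forall>A\<in>\<F>3. A \<subseteq> S \<longrightarrow> C A \<subseteq> \<F>3"
      using "1.IH"[OF S(2) S(1) F2(1-3)] by blast
    \<comment> \<open>A member not below \<open>S\<close> comes from \<open>\<F>2\<close> and
      differs from \<open>S\<close>, so it was complete there.\<close>
    have "\<forall>A\<in>\<F>3. A \<in> insert S \<S> \<or> A \<notin> \<F>1 \<longrightarrow> C A \<subseteq> \<F>3"
    proof (intro ballI impI)
      fix A assume A: "A \<in> \<F>3" "A \<in> insert S \<S> \<or> A \<notin> \<F>1"
      show "C A \<subseteq> \<F>3"
      proof (cases "A \<subseteq> S")
        case False
        then have "A \<in> \<F>2" "A \<in> \<S> \<or> A \<notin> \<F>1" using A F3(5) by auto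
        then show ?thesis using F2(6) F3(4) by blast
      qed (use A F3 in blast)
    qed
    moreover have "\<forall>A\<in>\<F>3 - \<F>1. A \<subset> E" using F2(5) F3(5) S(3) by blast
    moreover have "\<F>1 \<subseteq> \<F>3" using F2(4) F3(4) by (rule subset_trans)
    ultimately show ?case using F3(1-3) by (intro exI[of _ \<F>3] conjI)
  qed
  from this[of "{A\<in>\<F>1. A \<subset> E}"] F1(1)
  obtain \<F>' where F': "finite \<F>'" "\<F>' \<subseteq> \<B>" "Int_closed \<F>'" "\<F>1 \<subseteq> \<F>'" "\<forall>A\<in>\<F>' - \<F>1. A \<subset> E"
      "\<forall>A\<in>\<F>'. A \<in> {A\<in>\<F>1. A \<subset> E} \<or> A \<notin> \<F>1 \<longrightarrow> C A \<subseteq> \<F>'" by auto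
  \<comment> \<open>What remains is \<open>E\<close> itself, whose cover went into
    \<open>\<F>1\<close> at the start.\<close>
  have "\<forall>A\<in>\<F>'. A \<subseteq> E \<longrightarrow> C A \<subseteq> \<F>'"
  proof (intro ballI impI)
    fix A assume "A \<in> \<F>'" "A \<subseteq> E"
    then show "C A \<subseteq> \<F>'" using F'(4,6) F1(3) by (cases "A = E") auto
  qed
  moreover have "\<forall>A\<in>\<F>' - \<F>. A \<subseteq> E" using F'(5) F1E by blast
  moreover have "\<F> \<subseteq> \<F>'" using F1(3) F'(4) by blast
  ultimately show ?case using F'(1-3) by (intro exI[of _ \<F>'] conjI)
qed

section \<open>Initial segments and boxes\<close>

text \<open>Let \<open>z\<close> be the least element that ever leaves the sequence, with
  \<open>z\<close> outside \<open>J n\<close>. As an initial segment, \<open>J n\<close> lies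
  strictly below \<open>z\<close>, so nothing can leave it later.\<close>

lemma decreasing_initial_segments_stabilize:
  fixes J :: "nat \<Rightarrow> 'a set"
  assumes r: "Well_order r"
    and down: "\<And>n x y. \<lbrakk>x \<in> J n; (y, x) \<in> r\<rbrakk> \<Longrightarrow> y \<in> J n"
    and "\<And>n. J n \<subseteq> Field r" "decseq J"
  shows "\<exists>n. \<forall>m\<ge>n. J m = J n"
proof (cases "\<exists>n. J n \<noteq> J 0")
  case True
  then obtain x0 n0 where x0: "x0 \<in> J 0 - J n0" using decseqD[OF assms(4)] by blast
  have "wf (r - Id)" using r by (simp add: well_order_on_def)
  moreover have "x0 \<in> {x. \<exists>n. x \<in> J 0 - J n}" using x0 by blast
  ultimately obtain z where "z \<in> {x. \<exists>n. x \<in> J 0 - J n}"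
    and min: "\<And>y. (y, z) \<in> r - Id \<Longrightarrow> y \<notin> {x. \<exists>n. x \<in> J 0 - J n}"
    by (rule wfE_min) blast
  then obtain n where z: "z \<in> J 0 - J n" by blast
  have "J m = J n" if "m \<ge> n" for m
  proof (rule ccontr)
    assume "J m \<noteq> J n"
    moreover have "J m \<subseteq> J n" using decseqD[OF assms(4) that] .
    ultimately obtain y where y: "y \<in> J n" "y \<notin> J m" by blast
    then have "y \<noteq> z" "(z, y) \<notin> r" using z down by blast+
    moreover have "y \<in> Field r" "z \<in> Field r" using y z assms(3) by blast+
    ultimately have "(y, z) \<in> r - Id"
      using r by (auto simp: order_on_defs total_on_def)
    moreover have "y \<in> J 0 - J m" using y decseqD[OF assms(4), of 0 n] by blast
    ultimately show False using min by blast
  qed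
  then show ?thesis by blast
qed auto

locale ordinal_family =
  fixes I :: "'i set" and \<alpha> :: "'i \<Rightarrow> 'a rel"
  assumes finite_index: "finite I"
    and wo: "\<And>i. i \<in> I \<Longrightarrow> Well_order (\<alpha> i)"
begin

definition points :: "('i \<Rightarrow> 'a) set" where
  "points = (\<Pi>\<^sub>E i\<in>I. Field (\<alpha> i))"

definition below :: "('i \<Rightarrow> 'a) \<Rightarrow> ('i \<Rightarrow> 'a) \<Rightarrow> bool" where
  "below x y \<longleftrightarrow> (\<forall>i\<in>I. (x i, y i) \<in> \<alpha> i)"

definition initial :: "'i \<Rightarrow> 'a set \<Rightarrow> bool" where
  "initial i J \<longleftrightarrow> J \<subseteq> Field (\<alpha> i) \<and> (\<forall>x\<in>J. \<forall>y. (y, x) \<in> \<alpha> i \<longrightarrow> y \<in> J)"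

text \<open>The factors are initial segments and not given by upper bounds, since a factor may be
  unbounded in its ordinal.\<close>

definition box :: "('i \<Rightarrow> 'a) set \<Rightarrow> bool" where
  "box E \<longleftrightarrow> (\<exists>J. E = (\<Pi>\<^sub>E i\<in>I. J i) \<and> (\<forall>i\<in>I. initial i (J i)))"

text \<open>For a box \<open>E\<close> and \<open>a\<close> in \<open>points\<close>, the sets
  \<open>cut E i (a i)\<close> with \<open>i\<close> in \<open>I\<close> cover exactly the points of
  \<open>E\<close> that are not above \<open>a\<close>.\<close>

definition cut :: "('i \<Rightarrow> 'a) set \<Rightarrow> 'i \<Rightarrow> 'a \<Rightarrow> ('i \<Rightarrow> 'a) set" where
  "cut E i a = {y\<in>E. (y i, a) \<in> \<alpha> i - Id}"

lemma \<alpha>_refl: "\<lbrakk>i \<in> I; x \<in> Field (\<alpha> i)\<rbrakk> \<Longrightarrow> (x, x) \<in> \<alpha> i"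
  using wo[of i] by (auto simp: order_on_defs refl_on_def)

lemma \<alpha>_trans: "\<lbrakk>i \<in> I; (x, y) \<in> \<alpha> i; (y, z) \<in> \<alpha> i\<rbrakk> \<Longrightarrow> (x, z) \<in> \<alpha> i"
  using wo[of i] by (auto simp: order_on_defs dest: transD)

lemma \<alpha>_antisym: "\<lbrakk>i \<in> I; (x, y) \<in> \<alpha> i; (y, x) \<in> \<alpha> i\<rbrakk> \<Longrightarrow> x = y"
  using wo[of i] by (auto simp: order_on_defs dest: antisymD)

lemma \<alpha>_total: "\<lbrakk>i \<in> I; x \<in> Field (\<alpha> i); y \<in> Field (\<alpha> i)\<rbrakk> \<Longrightarrow> (x, y) \<in> \<alpha> i \<or> (y, x) \<in> \<alpha> i"
  using wo[of i] \<alpha>_refl by (cases "x = y") (auto simp: order_on_defs total_on_def)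

lemma below_trans: "\<lbrakk>below x y; below y z\<rbrakk> \<Longrightarrow> below x z"
  unfolding below_def using \<alpha>_trans by blast

lemma box_points: "box points"
  unfolding box_def points_def initial_def by (blast intro: FieldI1)

lemma box_subset_points: "box E \<Longrightarrow> E \<subseteq> points"
  unfolding box_def points_def initial_def by (elim exE conjE) (simp add: PiE_mono)

lemma box_Int:
  assumes "box A" "box B"
  shows "box (A \<inter> B)"
proof -
  obtain J K where "A = (\<Pi>\<^sub>E i\<in>I. J i)" "B = (\<Pi>\<^sub>E i\<in>I. K i)"
    "\<forall>i\<in>I. initial i (J i)" "\<forall>i\<in>I. initial i (K i)"
    using assms unfolding box_def by blast
  then have "A \<inter> B = (\<Pi>\<^sub>E i\<in>I. J i \<inter> K i)" "\<forall>i\<in>I. initial i (J i \<inter> K i)"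
    by (simp_all add: PiE_Int) (auto simp: initial_def)
  then show ?thesis unfolding box_def by blast
qed

lemma box_cut:
  assumes "box E" "i \<in> I"
  shows "box (cut E i a)"
proof -
  obtain J where J: "E = (\<Pi>\<^sub>E i\<in>I. J i)" "\<forall>i\<in>I. initial i (J i)"
    using assms unfolding box_def by blast
  let ?J = "J(i := {y \<in> J i. (y, a) \<in> \<alpha> i - Id})"
  have "cut E i a = (\<Pi>\<^sub>E i\<in>I. ?J i)"
    using \<open>i \<in> I\<close> unfolding cut_def J(1) by (fastforce simp: PiE_iff split: if_splits)
  moreover have "initial i (?J i)"
    unfolding initial_def
  proof (intro conjI ballI allI impI)
    show "?J i \<subseteq> Field (\<alpha> i)" using J(2) \<open>i \<in> I\<close> by (auto simp: initial_def)
    fix x y assume xy: "x \<in> ?J i" "(y, x) \<in> \<alpha> i"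
    then have "y \<in> J i" using J(2) \<open>i \<in> I\<close> unfolding initial_def by auto
    moreover have "(y, a) \<in> \<alpha> i" using xy \<alpha>_trans[OF \<open>i \<in> I\<close>] by auto
    moreover have "y \<noteq> a" using xy \<alpha>_antisym[OF \<open>i \<in> I\<close>] by auto
    ultimately show "y \<in> ?J i" by simp
  qed
  then have "\<forall>j\<in>I. initial j (?J j)" using J(2) by simp
  ultimately show ?thesis unfolding box_def by blast
qed

lemma cut_psubset:
  assumes "a \<in> E"
  shows "cut E i (a i) \<subset> E"
  using assms unfolding cut_def by blast

text \<open>Membership in a product of initial segments is tested coordinate by coordinate, so
  different members of \<open>E\<close> may bound different coordinates. This yields both downward
  closure and closure under coordinatewise maxima.\<close>

lemma box_mixI:
  assumes "box E" "x \<in> extensional I" "\<And>i. i \<in> I \<Longrightarrow> \<exists>y\<in>E. (x i, y i) \<in> \<alpha> i"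
  shows "x \<in> E"
proof -
  obtain J where J: "E = (\<Pi>\<^sub>E i\<in>I. J i)" "\<forall>i\<in>I. initial i (J i)"
    using assms unfolding box_def by blast
  have "x i \<in> J i" if "i \<in> I" for i
    using assms(3)[OF that] J that unfolding initial_def by (auto dest: PiE_mem)
  then show ?thesis using J assms(2) by (simp add: PiE_iff)
qed

lemma box_downward: "\<lbrakk>box E; x \<in> points; below x y; y \<in> E\<rbrakk> \<Longrightarrow> x \<in> E"
  by (rule box_mixI) (auto simp: points_def below_def PiE_iff)

lemma points_Field: "\<lbrakk>x \<in> points; i \<in> I\<rbrakk> \<Longrightarrow> x i \<in> Field (\<alpha> i)"
  by (simp add: points_def PiE_iff)

lemma below_refl: "x \<in> points \<Longrightarrow> below x x"
  unfolding below_def using \<alpha>_refl points_Field by blast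

lemma box_directed:
  assumes "box E" "x \<in> E" "finite S" "S \<subseteq> E"
  shows "\<exists>z\<in>E. below x z \<and> (\<forall>p\<in>S. below p z)"
  using assms(3,4)
proof (induction S rule: finite_induct)
  case empty
  then show ?case using assms below_refl box_subset_points by blast
next
  case (insert p S)
  then obtain z where z: "z \<in> E" "below x z" "\<forall>p\<in>S. below p z" by auto
  \<comment> \<open>The coordinatewise maximum of \<open>p\<close> and \<open>z\<close>; it stays in
    \<open>E\<close> because each coordinate comes from one of these two members.\<close>
  define w where "w = (\<lambda>i\<in>I. if (p i, z i) \<in> \<alpha> i then z i else p i)"
  have pz: "p \<in> points" "z \<in> points" "p \<in> E"
    using insert z box_subset_points[OF assms(1)] by auto
  have w: "(p i, w i) \<in> \<alpha> i" "(z i, w i) \<in> \<alpha> i" if "i \<in> I" for i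
    using that pz \<alpha>_refl \<alpha>_total[OF that, of "p i" "z i"] points_Field by (auto simp: w_def)
  have "w \<in> E"
  proof (rule box_mixI[OF assms(1)])
    show "\<exists>y\<in>E. (w i, y i) \<in> \<alpha> i" if "i \<in> I" for i
    proof (rule bexI)
      let ?y = "if (p i, z i) \<in> \<alpha> i then z else p"
      show "?y \<in> E" using pz z by simp
      show "(w i, ?y i) \<in> \<alpha> i"
        using that pz \<alpha>_refl[OF that] points_Field[OF _ that] by (simp add: w_def)
    qed
  qed (simp add: w_def)
  moreover have "below p w" "below z w" using w by (auto simp: below_def)
  ultimately show ?case using z below_trans by (metis insert_iff)
qed

text \<open>A strictly descending chain of boxes would give a decreasing sequence of initial
  segments in each coordinate. Each of these stabilizes, and as \<open>I\<close> is finite they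
  share a stage from which the chain would be constant.\<close>

lemma wf_box: "wf {(A, B). A \<in> Collect box \<and> B \<in> Collect box \<and> A \<subset> B}"
  unfolding wf_iff_no_infinite_down_chain
proof
  assume "\<exists>f. \<forall>n. (f (Suc n), f n) \<in> {(A, B). A \<in> Collect box \<and> B \<in> Collect box \<and> A \<subset> B}"
  then obtain f where "\<forall>n. box (f (Suc n)) \<and> box (f n) \<and> f (Suc n) \<subset> f n" by auto
  then have f: "\<And>n. box (f n)" "\<And>n. f (Suc n) \<subset> f n" by blast+
  have dec: "decseq f" using f(2) by (intro decseq_SucI) blast
  have "\<forall>n. \<exists>J. f n = (\<Pi>\<^sub>E i\<in>I. J i) \<and> (\<forall>i\<in>I. initial i (J i))"
    using f(1) unfolding box_def by blast
  then obtain J where J: "\<And>n. f n = (\<Pi>\<^sub>E i\<in>I. J n i)" "\<And>n i. i \<in> I \<Longrightarrow> initial i (J n i)"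
    by metis
  \<comment> \<open>An inclusion of products passes to the factors only when the smaller product is
    nonempty.\<close>
  have ne: "f n \<noteq> {}" for n using f(2)[of n] by blast
  have "\<exists>n. \<forall>m\<ge>n. J m i = J n i" if "i \<in> I" for i
  proof (rule decreasing_initial_segments_stabilize[OF wo[OF that]])
    show "decseq (\<lambda>n. J n i)"
    proof (rule decseq_SucI)
      fix n show "J (Suc n) i \<subseteq> J n i"
        using decseq_SucD[OF dec, of n] ne[of "Suc n"] that
        unfolding J(1) by (metis PiE_eq_empty_iff subset_PiE)
    qed
  qed (use J(2)[OF that] in \<open>auto simp: initial_def\<close>)
  then obtain N where N: "\<And>i m. \<lbrakk>i \<in> I; m \<ge> N i\<rbrakk> \<Longrightarrow> J m i = J (N i) i" by metis
  \<comment> \<open>The common stage; the \<open>0\<close> keeps \<open>Max\<close> meaningful when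
    \<open>I\<close> is empty.\<close>
  define M where "M = Max (insert 0 (N ` I))"
  have "N i \<le> M" if "i \<in> I" for i
    using that finite_index by (simp add: M_def)
  then have "J (Suc M) i = J M i" if "i \<in> I" for i
    using N that by (metis le_SucI)
  then have "f (Suc M) = f M" unfolding J(1) by (intro PiE_cong)
  then show False using f(2)[of M] by simp
qed

section \<open>The tuned partition\<close>

text \<open>\<open>r\<close> stands for either order, so one argument serves both frames. Blocks are
  named by the pairs \<open>(e x, c x)\<close>: which blocks a point sees is fixed by its least box
  alone, whereas the point reached must match both box and colour.\<close>

lemma tuned_refinement:
  fixes r :: "'i \<Rightarrow> 'a rel" and c :: "('i \<Rightarrow> 'a) \<Rightarrow> 'c"
  assumes fin: "finite (c ` points)"
    and r: "(\<forall>i\<in>I. r i = \<alpha> i) \<or> (\<forall>i\<in>I. r i = \<alpha> i - Id)"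
  obtains e :: "('i \<Rightarrow> 'a) \<Rightarrow> ('i \<Rightarrow> 'a) set" where "finite (e ` points)"
    "\<forall>x\<in>points. \<forall>x'\<in>points. \<forall>y\<in>points. e x = e x' \<longrightarrow> (\<forall>i\<in>I. (x i, y i) \<in> r i) \<longrightarrow>
      (\<exists>y'\<in>points. e y' = e y \<and> c y' = c y \<and> (\<forall>i\<in>I. (x' i, y' i) \<in> r i))"
proof -
  \<comment> \<open>An escaping \<open>a\<close> witnesses that the colour \<open>v\<close> is not
    cofinal in \<open>E\<close>; \<open>top\<close> marks a point attaining the maximum of
    \<open>E\<close> in coordinate \<open>i\<close>, needed for the strict order.\<close>
  define escapes where "escapes E v a \<longleftrightarrow> a \<in> E \<and> (\<forall>y\<in>E. c y = v \<longrightarrow> \<not> below a y)" for E v a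
  define top where "top E i a \<longleftrightarrow> a \<in> E \<and> (\<forall>y\<in>E. (y i, a i) \<in> \<alpha> i)" for E i a
  \<comment> \<open>Choosing one witness per colour and one per coordinate keeps \<open>M E\<close>
    finite.\<close>
  define M where "M E = {a. \<exists>v\<in>c ` points. (\<exists>b. escapes E v b) \<and> a = (SOME b. escapes E v b)} \<union>
    {a. \<exists>i\<in>I. (\<exists>b. top E i b) \<and> a = (SOME b. top E i b)}" for E
  \<comment> \<open>Each witness lies in \<open>E\<close> but in none of its own cuts, so for a box
    \<open>E\<close> these are proper subboxes.\<close>
  define C where "C E = {cut E i (a i) |i a. i \<in> I \<and> a \<in> M E}" for E
  have M_sub: "M E \<subseteq> E" for E
  proof
    fix a assume "a \<in> M E"
    then consider v where "\<exists>b. escapes E v b" "a = (SOME b. escapes E v b)"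
      | i where "\<exists>b. top E i b" "a = (SOME b. top E i b)"
      unfolding M_def by blast
    then show "a \<in> E"
      by cases (metis escapes_def someI_ex, metis top_def someI_ex)
  qed
  have M_escapes: "\<exists>a\<in>M E. escapes E v a" if "v \<in> c ` points" "escapes E v b" for E v b
  proof -
    have "escapes E v (SOME b. escapes E v b)" using that(2) by (rule someI[of "escapes E v"])
    then show ?thesis using that unfolding M_def by blast
  qed
  have M_top: "\<exists>a\<in>M E. top E i a" if "i \<in> I" "top E i b" for E i b
  proof -
    have "top E i (SOME b. top E i b)" using that(2) by (rule someI[of "top E i"])
    then show ?thesis using that unfolding M_def by blast
  qed
  have "finite (M E)" for E
  proof -
    have "M E \<subseteq> (\<lambda>v. SOME b. escapes E v b) ` c ` points \<union> (\<lambda>i. SOME b. top E i b) ` I"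
      unfolding M_def by blast
    then show ?thesis using fin finite_index by (meson finite_UnI finite_imageI finite_subset)
  qed
  then have C_fin: "finite (C E)" for E
  proof -
    have "C E = (\<lambda>(i, a). cut E i (a i)) ` (I \<times> M E)" unfolding C_def by auto
    then show ?thesis using \<open>finite (M E)\<close> finite_index by simp
  qed
  have C_box: "D \<in> Collect box \<and> D \<subset> E" if E: "E \<in> Collect box" and D: "D \<in> C E" for D E
  proof -
    obtain i a where "i \<in> I" "a \<in> M E" "D = cut E i (a i)" using D unfolding C_def by blast
    then show ?thesis using E M_sub box_cut cut_psubset by blast
  qed
  have "Int_closed (Collect box)" unfolding Int_closed_def using box_Int by blast
  moreover have "finite {points}" "{points} \<subseteq> Collect box" "Int_closed {points}"
    using box_points by (simp_all add: Int_closed_def)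
  ultimately have "\<exists>\<E>. finite \<E> \<and> \<E> \<subseteq> Collect box \<and> Int_closed \<E> \<and> {points} \<subseteq> \<E> \<and>
      (\<forall>A\<in>\<E> - {points}. A \<subseteq> points) \<and> (\<forall>E\<in>\<E>. E \<subseteq> points \<longrightarrow> C E \<subseteq> \<E>)"
    using C_fin C_box
    by (intro finite_Int_closed_cover_closed_below[OF wf_box, where C = C]) simp_all
  then obtain \<E> where \<E>: "finite \<E>" "\<E> \<subseteq> Collect box" "Int_closed \<E>" "points \<in> \<E>"
    and "\<forall>E\<in>\<E>. E \<subseteq> points \<longrightarrow> C E \<subseteq> \<E>"
    by (elim exE conjE) (simp add: that)
  then have \<E>_C: "C E \<subseteq> \<E>" if "E \<in> \<E>" for E
    using that box_subset_points by blast

  \<comment> \<open>For \<open>x\<close> in \<open>points\<close> this is the least member of \<E>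
    containing \<open>x\<close>, since \<E> is finite, intersection-closed and contains
    \<open>points\<close>.\<close>
  define e where "e x = \<Inter>{E\<in>\<E>. x \<in> E}" for x
  have e_in: "e x \<in> \<E>" if "x \<in> points" for x
    unfolding e_def using that \<E> by (intro Int_closed_Inter[OF \<E>(3)]) auto
  have e_self: "x \<in> e x" for x unfolding e_def by blast
  have e_least: "e x \<subseteq> E" if "E \<in> \<E>" "x \<in> E" for x E unfolding e_def using that by blast
  \<comment> \<open>Such a cut would be a member of \<E> containing \<open>x\<close> strictly inside
    the least one.\<close>
  have not_cut: "x \<notin> cut (e x) i (a i)" if "x \<in> points" "i \<in> I" "a \<in> M (e x)" for x i a
  proof
    assume "x \<in> cut (e x) i (a i)"
    moreover have "cut (e x) i (a i) \<in> \<E>"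
      using that e_in \<E>_C[of "e x"] unfolding C_def by blast
    moreover have "cut (e x) i (a i) \<subset> e x" using that M_sub cut_psubset by blast
    ultimately show False using e_least by blast
  qed
  have cofinal: "\<exists>y'\<in>points. e y' = e y \<and> c y' = c y \<and> below x y'"
    if x: "x \<in> e y" and y: "y \<in> points" for x y
  proof -
    let ?E = "e y"
    have E: "?E \<in> \<E>" "box ?E" "?E \<subseteq> points" using e_in[OF y] \<E>(2) box_subset_points by blast+
    \<comment> \<open>\<open>y\<close> lies in no cut of its least box, hence above every chosen
      witness; a witness against its own colour is thus impossible.\<close>
    have no_escape: "\<not> escapes ?E (c y) b" for b
    proof
      assume "escapes ?E (c y) b"
      then obtain a where a: "a \<in> M ?E" "escapes ?E (c y) a" using M_escapes y by blast
      then have "\<not> below a y" using e_self unfolding escapes_def by blast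
      then obtain i where i: "i \<in> I" "(a i, y i) \<notin> \<alpha> i" unfolding below_def by blast
      have "a \<in> points" using a M_sub E by blast
      then have "(y i, a i) \<in> \<alpha> i - Id"
        using i y \<alpha>_total[OF i(1), of "y i" "a i"] \<alpha>_refl[OF i(1)] points_Field by auto
      then have "y \<in> cut ?E i (a i)" using e_self unfolding cut_def by blast
      then show False using not_cut y i a by blast
    qed
    \<comment> \<open>One point of \<open>?E\<close> is picked outside each smaller member of \<E>.
      A point above all of them lies in no such member, because boxes are downward closed.\<close>
    have "\<forall>D\<in>{D\<in>\<E>. D \<subset> ?E}. \<exists>p. p \<in> ?E - D" by blast
    from bchoice[OF this] obtain p where p: "\<And>D. \<lbrakk>D \<in> \<E>; D \<subset> ?E\<rbrakk> \<Longrightarrow> p D \<in> ?E - D"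
      by blast
    obtain z where z: "z \<in> ?E" "below x z" "\<And>D. \<lbrakk>D \<in> \<E>; D \<subset> ?E\<rbrakk> \<Longrightarrow> below (p D) z"
    proof -
      have "finite (p ` {D\<in>\<E>. D \<subset> ?E})" "p ` {D\<in>\<E>. D \<subset> ?E} \<subseteq> ?E" using \<E>(1) p by auto
      from box_directed[OF E(2) x this] show ?thesis using that by blast
    qed
    obtain y' where y': "y' \<in> ?E" "c y' = c y" "below z y'"
      using no_escape[of z] z unfolding escapes_def by blast
    have "\<not> e y' \<subset> ?E"
    proof
      assume lt: "e y' \<subset> ?E"
      have D: "e y' \<in> \<E>" "box (e y')" using e_in y' E(3) \<E>(2) by blast+
      have "below (p (e y')) y'" using z(3) D lt y'(3) below_trans by blast
      then have "p (e y') \<in> e y'"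
        using box_downward[OF D(2)] e_self p[OF D(1) lt] E(3) by blast
      then show False using p[OF D(1) lt] by blast
    qed
    then have "e y' = ?E" using e_least[OF E(1) y'(1)] by blast
    then show ?thesis using y' z E below_trans by blast
  qed
  \<comment> \<open>If the strict case failed, \<open>x' i\<close> would be the maximum of
    \<open>e y\<close> in coordinate \<open>i\<close>, hence also that of \<open>e x\<close>. The
    points of \<open>e x\<close> below this maximum then form a cut, which omits \<open>x\<close>;
    so \<open>x i\<close> attains the maximum too and cannot be strictly below
    \<open>y i\<close>.\<close>
  have step: "\<exists>z\<in>e y. (x' i, z i) \<in> r i"
    if pts: "x \<in> points" "x' \<in> points" "y \<in> points" and "e x = e x'"
      and sub: "e x \<subseteq> e y" and i: "i \<in> I" and xy: "(x i, y i) \<in> r i" for x x' y i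
  proof (cases "r i = \<alpha> i")
    case True
    moreover have "x' \<in> e y" using e_self \<open>e x = e x'\<close> sub by blast
    ultimately show ?thesis using \<alpha>_refl i pts points_Field by metis
  next
    case False
    then have ri: "r i = \<alpha> i - Id" using r i by blast
    show ?thesis
    proof (rule ccontr)
      assume no: "\<not> ?thesis"
      have "(z i, x' i) \<in> \<alpha> i" if "z \<in> e y" for z
      proof -
        have "z \<in> points" using that e_in[OF pts(3)] \<E>(2) box_subset_points by blast
        then show ?thesis
          using no that ri i pts \<alpha>_total[OF i, of "z i" "x' i"] \<alpha>_refl[OF i] points_Field by auto
      qed
      then have max: "(y i, x' i) \<in> \<alpha> i" "\<And>z. z \<in> e x \<Longrightarrow> (z i, x' i) \<in> \<alpha> i"
        using e_self sub by blast+
      then have "top (e x) i x'"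
        using e_self \<open>e x = e x'\<close> unfolding top_def by blast
      then obtain a where a: "a \<in> M (e x)" "top (e x) i a" using M_top i by blast
      have "(x i, a i) \<in> \<alpha> i" "(x' i, a i) \<in> \<alpha> i"
        using a(2) e_self \<open>e x = e x'\<close> unfolding top_def by blast+
      moreover have "x \<notin> cut (e x) i (a i)" using not_cut pts i a by blast
      then have "(x i, a i) \<notin> \<alpha> i - Id" using e_self unfolding cut_def by blast
      ultimately have "(x' i, x i) \<in> \<alpha> i" by auto
      then have "(y i, x i) \<in> \<alpha> i" using max(1) \<alpha>_trans i by blast
      then show False using xy ri \<alpha>_antisym i by blast
    qed
  qed
  show thesis
  proof
    have "e ` points \<subseteq> \<E>" using e_in by blast
    then show "finite (e ` points)" using \<E>(1) finite_subset by blast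
  next
    show "\<forall>x\<in>points. \<forall>x'\<in>points. \<forall>y\<in>points. e x = e x' \<longrightarrow> (\<forall>i\<in>I. (x i, y i) \<in> r i) \<longrightarrow>
      (\<exists>y'\<in>points. e y' = e y \<and> c y' = c y \<and> (\<forall>i\<in>I. (x' i, y' i) \<in> r i))"
    proof (intro ballI impI)
      fix x x' y
      assume pts: "x \<in> points" "x' \<in> points" "y \<in> points" and ee: "e x = e x'"
        and xy: "\<forall>i\<in>I. (x i, y i) \<in> r i"
      have boxy: "box (e y)" "e y \<in> \<E>" using e_in[OF pts(3)] \<E>(2) by blast+
      have "below x y" using xy r unfolding below_def by blast
      then have "x \<in> e y" using box_downward[OF boxy(1) pts(1)] e_self by blast
      then have "e x \<subseteq> e y" using e_least boxy by blast
      then have "\<forall>i\<in>I. \<exists>z\<in>e y. (x' i, z i) \<in> r i" using step pts ee xy by blast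
      then obtain w where w: "\<And>i. i \<in> I \<Longrightarrow> w i \<in> e y \<and> (x' i, w i i) \<in> r i" by metis
      \<comment> \<open>The witnesses for different coordinates may be different points; the box
        allows mixing them into one, which cofinality then raises into the block of
        \<open>y\<close>.\<close>
      define z where "z = (\<lambda>i\<in>I. w i i)"
      have "z \<in> e y"
      proof (rule box_mixI[OF boxy(1)])
        show "\<exists>u\<in>e y. (z i, u i) \<in> \<alpha> i" if "i \<in> I" for i
          using w[OF that] that box_subset_points[OF boxy(1)] \<alpha>_refl[OF that] points_Field
          by (intro bexI[of _ "w i"]) (auto simp: z_def)
      qed (simp add: z_def)
      then obtain y' where y': "y' \<in> points" "e y' = e y" "c y' = c y" "below z y'"
        using cofinal pts by blast
      have "(x' i, y' i) \<in> r i" if i: "i \<in> I" for i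
      proof -
        \<comment> \<open>A step along \<open>r i\<close> followed by a non-strict step is again a
          step along \<open>r i\<close>, for either order.\<close>
        have 1: "(x' i, z i) \<in> r i" "(z i, y' i) \<in> \<alpha> i"
          using w[OF i] i y'(4) by (auto simp: z_def below_def)
        then show ?thesis
          using r i \<alpha>_trans[OF i] \<alpha>_antisym[OF i] by (metis DiffD1 DiffD2 DiffI IdI pair_in_Id_conv)
      qed
      then show "\<exists>y'\<in>points. e y' = e y \<and> c y' = c y \<and> (\<forall>i\<in>I. (x' i, y' i) \<in> r i)"
        using y' by blast
    qed
  qed
qed

section \<open>Local finiteness for both orders\<close>

lemma locally_finite_direct_product:
  assumes r: "(\<forall>i\<in>I. r i = \<alpha> i) \<or> (\<forall>i\<in>I. r i = \<alpha> i - Id)"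
  shows "locally_finite (complex_algebra (direct_product I (\<lambda>i. \<lparr>worlds = Field (\<alpha> i), acc = r i\<rparr>)))"
    (is "locally_finite (complex_algebra ?F)")
proof (rule locally_finite_complex_algebraI)
  fix G :: "('i \<Rightarrow> 'a) set set"
  assume G: "finite G"
  have X: "worlds ?F = points"
    and acc: "acc ?F = {(x, y) \<in> points \<times> points. \<forall>i\<in>I. (x i, y i) \<in> r i}"
    by (simp_all add: direct_product_def Let_def points_def)
  \<comment> \<open>Colouring a point by the generators that contain it makes each generator a union
    of colour classes within \<open>points\<close>.\<close>
  define c where "c x = {U\<in>G. x \<in> U}" for x
  have "c ` points \<subseteq> Pow G" by (auto simp: c_def)
  then have "finite (c ` points)" using G by (meson finite_Pow_iff finite_subset)
  then obtain e :: "('i \<Rightarrow> 'a) \<Rightarrow> ('i \<Rightarrow> 'a) set" where e: "finite (e ` points)"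
    "\<forall>x\<in>points. \<forall>x'\<in>points. \<forall>y\<in>points. e x = e x' \<longrightarrow> (\<forall>i\<in>I. (x i, y i) \<in> r i) \<longrightarrow>
      (\<exists>y'\<in>points. e y' = e y \<and> c y' = c y \<and> (\<forall>i\<in>I. (x' i, y' i) \<in> r i))"
    by (rule tuned_refinement[OF _ r])
  define k where "k x = (e x, c x)" for x
  have "k ` points \<subseteq> e ` points \<times> c ` points" by (auto simp: k_def)
  then have "finite (k ` points)"
    using e(1) \<open>finite (c ` points)\<close> by (meson finite_SigmaI finite_subset)
  moreover have "\<forall>U\<in>G. \<forall>x\<in>points. \<forall>y\<in>points. k x = k y \<longrightarrow> x \<in> U \<longrightarrow> y \<in> U"
    by (auto simp: k_def c_def)
  moreover have "\<forall>x\<in>points. \<forall>x'\<in>points. \<forall>y\<in>points. k x = k x' \<longrightarrow> (x, y) \<in> acc ?F \<longrightarrow>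
        (\<exists>y'\<in>points. k y' = k y \<and> (x', y') \<in> acc ?F)"
  proof (intro ballI impI)
    fix x x' y
    assume pts: "x \<in> points" "x' \<in> points" "y \<in> points" and "k x = k x'" "(x, y) \<in> acc ?F"
    then have "e x = e x'" "\<forall>i\<in>I. (x i, y i) \<in> r i" by (auto simp: k_def acc)
    then obtain y' where "y' \<in> points" "e y' = e y" "c y' = c y" "\<forall>i\<in>I. (x' i, y' i) \<in> r i"
      using e(2) pts by blast
    then show "\<exists>y'\<in>points. k y' = k y \<and> (x', y') \<in> acc ?F"
      using pts by (auto simp: k_def acc)
  qed
  ultimately show "\<exists>k :: ('i \<Rightarrow> 'a) \<Rightarrow> ('i \<Rightarrow> 'a) set \<times> ('i \<Rightarrow> 'a) set set.
      finite (k ` worlds ?F) \<and>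
      (\<forall>U\<in>G. \<forall>x\<in>worlds ?F. \<forall>y\<in>worlds ?F. k x = k y \<longrightarrow> x \<in> U \<longrightarrow> y \<in> U) \<and>
      (\<forall>x\<in>worlds ?F. \<forall>x'\<in>worlds ?F. \<forall>y\<in>worlds ?F. k x = k x' \<longrightarrow> (x, y) \<in> acc ?F \<longrightarrow>
        (\<exists>y'\<in>worlds ?F. k y' = k y \<and> (x', y') \<in> acc ?F))"
    unfolding X by blast
qed

end

theorem mainTheorem5:
  fixes I :: "'i set" and \<alpha> :: "'i \<Rightarrow> 'a rel"
  assumes "finite I"
    and "\<And>i. i \<in> I \<Longrightarrow> Well_order (\<alpha> i)"
  shows "locally_finite (complex_algebra (direct_product I (\<lambda>i. ord_le_frame (\<alpha> i)))) \<and>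
         locally_finite (complex_algebra (direct_product I (\<lambda>i. ord_less_frame (\<alpha> i))))"
proof -
  interpret ordinal_family I \<alpha> by unfold_locales fact+
  show ?thesis
    unfolding ord_le_frame_def ord_less_frame_def
    by (simp add: locally_finite_direct_product)
qed

end
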